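(* Let $\epsilon>0$ and let $\{\omega_n\}_{n=1}^\infty$ be an increasing sequence of positive real numbers such that $\int_{\omega_n}^\infty \Xi(t)\,dt=0$ and $\omega_{n+1}-\omega_n<\omega_n^{\frac16+\epsilon}$ for all $n=1,2,\dots$. For each $n$ let $\{c\}_n$ be the set of mean-value points of $\Xi$ on $[\omega_n,\omega_{n+1}]$, that is, the set of all $c\in(\omega_n,\omega_{n+1})$ with $$\int_{\omega_n}^{\omega_{n+1}}\Xi(t)\,dt=\Xi(c)\,(\omega_{n+1}-\omega_n),$$ and let $\{\gamma\}_n$ be the set of zeros $\gamma\in(\omega_n,\omega_{n+1})$ of $\Xi$, where $\Xi(\gamma)=0\Leftrightarrow\zeta\left(\frac12+i\gamma\right)=0$. Then $$\{c\}_n=\{\gamma\}_n,\qquad n=1,2,\dots.$$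
   Context: Here $\Xi(z)=\xi\left(\frac12+iz\right)$, where $\xi(s)=\frac{s(s-1)}{2}\pi^{-s/2}\Gamma\left(\frac s2\right)\zeta(s)$, with $\zeta$ the Riemann zeta-function and $\Gamma$ the Gamma function. The function $\Xi(t)$ is real for real $t$. *)

theory Defs
  imports "HOL-Complex_Analysis.Complex_Analysis"
begin

section \<open>The Riemann zeta-function\<close>

text \<open>
  The zeta-function is the unique analytic continuation of the Dirichlet series to the plane
  without the pole \<open>1\<close>, where it is given the value \<open>0\<close>. The theorem \<open>zeta_unique_continuation\<close> below
  shows that the description is proper.
\<close>

definition zeta_continuation :: "(complex \<Rightarrow> complex) \<Rightarrow> bool" where
  "zeta_continuation f \<longleftrightarrow>
     f holomorphic_on - {1} \<and>
     (\<forall>s. Re s > 1 \<longrightarrow> (\<lambda>n. 1 / of_nat (Suc n) powr s) sums f s) \<and>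
     f 1 = 0"

definition zeta :: "complex \<Rightarrow> complex" where
  "zeta = (THE f. zeta_continuation f)"

text \<open>
  The continuation exists: expand \<open>(N+1) powr (1-s) - N powr (1-s)\<close> by Taylor's formula and sum
  over \<open>N\<close>. This expresses \<open>(s-1) * zeta s\<close> by the same function at \<open>s+1, s+2, \<dots>\<close> and
  by a remainder series that converges in a larger half-plane.
\<close>

definition zeta_ff :: "nat \<Rightarrow> complex \<Rightarrow> complex" where
  "zeta_ff i s = (\<Prod>j<i. 1 - s - of_nat j)"

definition zeta_rem :: "nat \<Rightarrow> nat \<Rightarrow> complex \<Rightarrow> complex" where
  "zeta_rem K n s = of_nat (Suc (Suc n)) powr (1 - s)
     - (\<Sum>i\<le>Suc K. zeta_ff i s * of_nat (Suc n) powr (1 - s - of_nat i) / fact i)"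

definition dirichlet_one :: "complex \<Rightarrow> complex" where
  "dirichlet_one s = (\<Sum>n. of_nat (Suc n) powr (- s))"

lemma zeta_ff_Suc: "zeta_ff (Suc i) s = zeta_ff i s * (1 - s - of_nat i)"
  by (simp add: zeta_ff_def)

lemma zeta_ff_holo [holomorphic_intros]: "zeta_ff i holomorphic_on A"
  unfolding zeta_ff_def by (intro holomorphic_intros)

lemma norm_of_nat_powr: "cmod (of_nat (Suc n) powr z) = real (Suc n) powr Re z"
  by (subst norm_powr_real_powr) (auto simp del: of_nat_Suc)

lemma zeta_rem_bound:
  assumes "Re s > - real K - 1"
  shows "cmod (zeta_rem K n s)
           \<le> cmod (zeta_ff (Suc (Suc K)) s) * real (Suc n) powr (- 1 - real K - Re s)"
proof -
  let ?S = "closed_segment (of_nat (Suc n) :: complex) (of_nat (Suc (Suc n)))"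
  let ?f = "\<lambda>i x. zeta_ff i s * x powr (1 - s - of_nat i)"
  let ?B = "cmod (zeta_ff (Suc (Suc K)) s) * real (Suc n) powr (- 1 - real K - Re s)"
  have S: "x \<in> \<real> \<and> Re x \<ge> real (Suc n)" if x: "x \<in> ?S" for x
  proof -
    have "?S = of_real ` closed_segment (real (Suc n)) (real (Suc (Suc n)))"
      using closed_segment_of_real[of "real (Suc n)" "real (Suc (Suc n))"] by simp
    then obtain y where "y \<in> closed_segment (real (Suc n)) (real (Suc (Suc n)))" "x = of_real y"
      using x by auto
    then show ?thesis by (auto simp: closed_segment_eq_real_ivl)
  qed
  have "cmod (?f 0 (of_nat (Suc (Suc n))) -
          (\<Sum>i\<le>Suc K. ?f i (of_nat (Suc n)) * (of_nat (Suc (Suc n)) - of_nat (Suc n)) ^ i / fact i))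
        \<le> ?B * cmod (of_nat (Suc (Suc n)) - of_nat (Suc n)) ^ Suc (Suc K) / fact (Suc K)"
  proof (rule complex_Taylor)
    fix i x assume x: "x \<in> ?S"
    from S[OF x] have "x \<notin> \<real>\<^sub>\<le>\<^sub>0"
      by (auto simp: complex_nonpos_Reals_iff)
    then have "((\<lambda>z. z powr (1 - s - of_nat i)) has_field_derivative
        (1 - s - of_nat i) * x powr (1 - s - of_nat i - 1)) (at x within ?S)"
      by (rule has_field_derivative_at_within[OF has_field_derivative_powr])
    from DERIV_cmult[OF this, of "zeta_ff i s"]
    show "(?f i has_field_derivative ?f (Suc i) x) (at x within ?S)"
      by (simp add: zeta_ff_Suc algebra_simps)
  next
    fix x assume x: "x \<in> ?S"
    have "cmod (x powr (1 - s - of_nat (Suc (Suc K)))) = Re x powr (- 1 - real K - Re s)"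
      using S[OF x] by (subst norm_powr_real_powr) (auto simp: algebra_simps)
    also have "\<dots> \<le> real (Suc n) powr (- 1 - real K - Re s)"
      using S[OF x] assms by (intro powr_mono2') auto
    finally show "cmod (?f (Suc (Suc K)) x) \<le> ?B"
      by (simp only: norm_mult) (intro mult_left_mono, auto)
  qed auto
  then have "cmod (zeta_rem K n s) \<le> ?B / fact (Suc K)"
    by (simp add: zeta_rem_def zeta_ff_def)
  also have "\<dots> \<le> ?B"
    using divide_left_mono[OF fact_ge_1[of "Suc K", where 'a=real], of ?B] by (simp del: fact_Suc)
  finally show ?thesis .
qed

lemma summable_Suc_powr:
  assumes "a < - 1" shows "summable (\<lambda>n. real (Suc n) powr a)"
  using assms summable_real_powr_iff[of a] summable_Suc_iff[of "\<lambda>n. real n powr a"] by simp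

lemma zeta_rem_summable:
  assumes "Re s > - real K" shows "summable (\<lambda>n. zeta_rem K n s)"
proof (rule summable_comparison_test')
  show "summable (\<lambda>n. cmod (zeta_ff (Suc (Suc K)) s) * real (Suc n) powr (- 1 - real K - Re s))"
    using assms by (intro summable_mult summable_Suc_powr) auto
  show "norm (zeta_rem K n s)
          \<le> cmod (zeta_ff (Suc (Suc K)) s) * real (Suc n) powr (- 1 - real K - Re s)" for n
    using assms by (intro zeta_rem_bound) auto
qed

lemma zeta_rem_series_holo:
  "(\<lambda>s. \<Sum>n. zeta_rem K n s) holomorphic_on {s. Re s > - real K}"
proof (rule holomorphic_uniform_sequence)
  let ?S = "{s. Re s > - real K}"
  show S: "open ?S" by (rule open_halfspace_Re_gt)
  show "(\<lambda>s. \<Sum>i<n. zeta_rem K i s) holomorphic_on ?S" for n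
    unfolding zeta_rem_def by (intro holomorphic_intros) (auto simp flip: of_nat_Suc)
  fix x assume "x \<in> ?S"
  with S obtain d where d: "d > 0" "cball x d \<subseteq> ?S"
    by (meson open_contains_cball)
  have "x - of_real d \<in> cball x d" using d by (simp add: dist_norm)
  then have "x - of_real d \<in> ?S" using d(2) by (rule subsetD[rotated])
  then have m: "Re x - d > - real K" by simp
  have "compact ((\<lambda>s. cmod (zeta_ff (Suc (Suc K)) s)) ` cball x d)"
    by (intro compact_continuous_image continuous_intros holomorphic_on_imp_continuous_on
        holomorphic_intros) auto
  then obtain C where C: "\<And>s. s \<in> cball x d \<Longrightarrow> cmod (zeta_ff (Suc (Suc K)) s) \<le> C"
    unfolding compact_eq_bounded_closed bounded_iff by force
  have "uniform_limit (cball x d) (\<lambda>n s. \<Sum>i<n. zeta_rem K i s) (\<lambda>s. \<Sum>n. zeta_rem K n s)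
          sequentially"
  proof (rule Weierstrass_m_test)
    show "summable (\<lambda>n. C * real (Suc n) powr (- 1 - real K - (Re x - d)))"
      using m by (intro summable_mult summable_Suc_powr) auto
    fix n s assume s: "s \<in> cball x d"
    have "\<bar>Re (x - s)\<bar> \<le> d" 
      using s abs_Re_le_cmod[of "x - s"] by (simp add: dist_norm)
    then have re: "Re s \<ge> Re x - d" by auto
    have "norm (zeta_rem K n s)
            \<le> cmod (zeta_ff (Suc (Suc K)) s) * real (Suc n) powr (- 1 - real K - Re s)"
      using s d by (intro zeta_rem_bound) auto
    also have "\<dots> \<le> C * real (Suc n) powr (- 1 - real K - (Re x - d))"
      using C[OF s] re order_trans[OF norm_ge_zero C[OF s]]
      by (intro mult_mono powr_mono) auto
    finally show "norm (zeta_rem K n s) \<le> \<dots>" .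
  qed
  with d show "\<exists>d>0. cball x d \<subseteq> ?S \<and>
      uniform_limit (cball x d) (\<lambda>n s. \<Sum>i<n. zeta_rem K i s) (\<lambda>s. \<Sum>n. zeta_rem K n s) sequentially"
    by blast
qed

lemma dirichlet_one_sums:
  assumes "Re s > 1" shows "(\<lambda>n. of_nat (Suc n) powr (- s)) sums dirichlet_one s"
  unfolding dirichlet_one_def
proof (rule summable_sums, rule summable_norm_cancel)
  show "summable (\<lambda>n. cmod (of_nat (Suc n) powr (- s)))"
    unfolding norm_of_nat_powr using assms by (intro summable_Suc_powr) auto
qed

lemma dirichlet_one_recursion:
  assumes s: "Re s > 1"
  shows "(s - 1) * dirichlet_one s =
    1 + (\<Sum>n. zeta_rem K n s)
      - (\<Sum>j=1..K. zeta_ff j s / fact (Suc j) * ((s + of_nat j - 1) * dirichlet_one (s + of_nat j)))"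
proof -
  let ?g = "\<lambda>n. of_nat (Suc n) powr (1 - s) :: complex"
  have "(\<lambda>n. norm (?g n)) \<longlonglongrightarrow> 0"
    unfolding norm_of_nat_powr using s
    by (intro tendsto_neg_powr filterlim_compose[OF filterlim_real_sequentially filterlim_Suc]) auto
  then have "?g \<longlonglongrightarrow> 0" by (rule tendsto_norm_zero_cancel)
  from telescope_sums[OF this] have 1: "(\<lambda>n. ?g (Suc n) - ?g n) sums (- 1)" by simp
  have "(\<lambda>n. \<Sum>j=0..K. zeta_ff (Suc j) s / fact (Suc j) * of_nat (Suc n) powr (- (s + of_nat j))) sums
        (\<Sum>j=0..K. zeta_ff (Suc j) s / fact (Suc j) * dirichlet_one (s + of_nat j))"
    using s by (intro sums_sum sums_mult dirichlet_one_sums) auto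
  moreover have "(\<lambda>n. zeta_rem K n s) sums (\<Sum>n. zeta_rem K n s)"
    using s by (intro summable_sums zeta_rem_summable) auto
  ultimately have "(\<lambda>n. (\<Sum>j=0..K. zeta_ff (Suc j) s / fact (Suc j) * of_nat (Suc n) powr (- (s + of_nat j)))
          + zeta_rem K n s) sums
        ((\<Sum>j=0..K. zeta_ff (Suc j) s / fact (Suc j) * dirichlet_one (s + of_nat j))
          + (\<Sum>n. zeta_rem K n s))"
    by (rule sums_add)
  also have "(\<lambda>n. (\<Sum>j=0..K. zeta_ff (Suc j) s / fact (Suc j) * of_nat (Suc n) powr (- (s + of_nat j)))
          + zeta_rem K n s) = (\<lambda>n. ?g (Suc n) - ?g n)"
  proof
    fix n
    have "(\<Sum>i\<le>Suc K. zeta_ff i s * of_nat (Suc n) powr (1 - s - of_nat i) / fact i)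
        = ?g n + (\<Sum>j\<le>K. zeta_ff (Suc j) s * of_nat (Suc n) powr (1 - s - of_nat (Suc j)) / fact (Suc j))"
      by (subst sum.atMost_Suc_shift) (simp add: zeta_ff_def)
    also have "(\<Sum>j\<le>K. zeta_ff (Suc j) s * of_nat (Suc n) powr (1 - s - of_nat (Suc j)) / fact (Suc j))
       = (\<Sum>j=0..K. zeta_ff (Suc j) s / fact (Suc j) * of_nat (Suc n) powr (- (s + of_nat j)))"
      unfolding atLeast0AtMost by (intro sum.cong refl) simp
    finally show "(\<Sum>j=0..K. zeta_ff (Suc j) s / fact (Suc j) * of_nat (Suc n) powr (- (s + of_nat j)))
          + zeta_rem K n s = ?g (Suc n) - ?g n"
      by (simp add: zeta_rem_def)
  qed
  finally have "(\<Sum>j=0..K. zeta_ff (Suc j) s / fact (Suc j) * dirichlet_one (s + of_nat j))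
          + (\<Sum>n. zeta_rem K n s) = - 1"
    using 1 sums_unique2 by blast
  moreover have "(\<Sum>j=0..K. zeta_ff (Suc j) s / fact (Suc j) * dirichlet_one (s + of_nat j))
      = - ((s - 1) * dirichlet_one s)
        + (\<Sum>j=1..K. zeta_ff (Suc j) s / fact (Suc j) * dirichlet_one (s + of_nat j))"
    by (subst sum.atLeast_Suc_atMost) (auto simp: zeta_ff_def algebra_simps)
  moreover have "(\<Sum>j=1..K. zeta_ff (Suc j) s / fact (Suc j) * dirichlet_one (s + of_nat j))
      = - (\<Sum>j=1..K. zeta_ff j s / fact (Suc j) * ((s + of_nat j - 1) * dirichlet_one (s + of_nat j)))"
    unfolding sum_negf[symmetric]
    by (intro sum.cong refl) (simp add: zeta_ff_Suc divide_simps algebra_simps del: fact_Suc)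
  moreover have "X = 1 + R - C" if "A + R = - 1" "A = - X + B" "B = - C" for A B C R X :: complex
  proof -
    from that have "- X - C + R = - 1" by simp
    then show ?thesis by (simp add: algebra_simps eq_neg_iff_add_eq_0)
  qed
  ultimately show ?thesis by blast
qed

lemma zeta_continuation_halfplane:
  "\<exists>Z. Z holomorphic_on {s. Re s > 1 - real K} \<and>
       (\<forall>s. Re s > 1 \<longrightarrow> Z s = (s - 1) * dirichlet_one s)"
proof (induction K)
  case 0
  let ?R = "\<lambda>s. 1 + (\<Sum>n. zeta_rem 0 n s)"
  have "?R holomorphic_on {s. Re s > 1 - real 0}"
    using zeta_rem_series_holo[of 0]
    by (intro holomorphic_intros) (auto elim: holomorphic_on_subset)
  moreover have "\<forall>s. Re s > 1 \<longrightarrow> ?R s = (s - 1) * dirichlet_one s"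
    using dirichlet_one_recursion[of _ 0] by simp
  ultimately show ?case by (intro exI[of _ ?R]) blast
next
  case (Suc K)
  then obtain Z where Z: "Z holomorphic_on {s. Re s > 1 - real K}"
      "\<And>s. Re s > 1 \<Longrightarrow> Z s = (s - 1) * dirichlet_one s"
    by blast
  let ?W = "\<lambda>s. 1 + (\<Sum>n. zeta_rem K n s)
      - (\<Sum>j=1..K. zeta_ff j s / fact (Suc j) * Z (s + of_nat j))"
  have "(\<lambda>s. Z (s + of_nat j)) holomorphic_on {s. Re s > 1 - real (Suc K)}" if "j \<in> {1..K}" for j
    using that
    by (intro holomorphic_on_compose_gen[OF _ Z(1), unfolded o_def] holomorphic_intros) auto
  then have "?W holomorphic_on {s. Re s > 1 - real (Suc K)}"
    using zeta_rem_series_holo[of K]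
    by (intro holomorphic_intros) (auto elim: holomorphic_on_subset)
  moreover have "\<forall>s. Re s > 1 \<longrightarrow> ?W s = (s - 1) * dirichlet_one s"
    by (auto simp: dirichlet_one_recursion[of _ K] Z(2) simp del: fact_Suc)
  ultimately show ?case by (intro exI[of _ ?W]) blast
qed

lemma zeta_continuation_entire:
  "\<exists>Z. Z holomorphic_on UNIV \<and> (\<forall>s. Re s > 1 \<longrightarrow> Z s = (s - 1) * dirichlet_one s)"
proof -
  obtain Z where Z: "\<And>K. Z K holomorphic_on {s. Re s > 1 - real K}"
      "\<And>K s. Re s > 1 \<Longrightarrow> Z K s = (s - 1) * dirichlet_one s"
    using zeta_continuation_halfplane by metis
  have agree: "Z K s = Z J s" if "K \<le> J" "Re s > 1 - real K" for K J s
  proof (rule analytic_continuation_open[of "{s. Re s > 1}" "{s. Re s > 1 - real K}" "Z K" "Z J"])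
    show "{s. Re s > 1} \<noteq> {}" by (auto intro!: exI[of _ 2])
    show "Z J holomorphic_on {s. Re s > 1 - real K}"
      using that by (intro holomorphic_on_subset[OF Z(1)]) auto
  qed (use that Z in \<open>auto intro: open_halfspace_Re_gt convex_connected convex_halfspace_Re_gt\<close>)
  define k where "k = (\<lambda>s. nat \<lceil>2 - Re s\<rceil>)"
  have k: "Re s > 1 - real (k s)" for s unfolding k_def by linarith
  define Y where "Y = (\<lambda>s. Z (k s) s)"
  have Y: "Y s = Z K s" if "Re s > 1 - real K" for K s
  proof (cases "K \<le> k s")
    case True
    then show ?thesis using agree[OF True that] by (simp only: Y_def)
  next
    case False
    then have "k s \<le> K" by simp
    then show ?thesis using agree[OF _ k] by (simp only: Y_def)
  qed
  have "Y field_differentiable at s" for s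
  proof -
    have o: "open {w. Re w > 1 - real (k s)}" by (rule open_halfspace_Re_gt)
    have "Y holomorphic_on {w. Re w > 1 - real (k s)}"
      using Z(1)[of "k s"] by (rule holomorphic_transform) (simp add: Y)
    then show ?thesis using k[of s] o by (intro holomorphic_on_imp_differentiable_at) auto
  qed
  then have "Y holomorphic_on UNIV" by (simp add: holomorphic_on_def)
  moreover have "Y s = (s - 1) * dirichlet_one s" if "Re s > 1" for s
    using Y[of 0 s] Z(2)[of s 0] that by simp
  ultimately show ?thesis by blast
qed

theorem zeta_unique_continuation: "\<exists>!f. zeta_continuation f"
proof (rule ex_ex1I)
  obtain Z where Z: "Z holomorphic_on UNIV"
      "\<And>s. Re s > 1 \<Longrightarrow> Z s = (s - 1) * dirichlet_one s"
    using zeta_continuation_entire by blast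
  let ?f = "\<lambda>s. if s = 1 then 0 else Z s / (s - 1)"
  have "(\<lambda>s. Z s / (s - 1)) holomorphic_on - {1}"
    using Z(1) by (intro holomorphic_intros) (auto elim: holomorphic_on_subset)
  then have "?f holomorphic_on - {1}"
    by (rule holomorphic_transform) auto
  moreover have "(\<lambda>n. 1 / of_nat (Suc n) powr s) sums ?f s" if "Re s > 1" for s
  proof -
    have "s \<noteq> 1" using that by auto
    then have "?f s = dirichlet_one s" using Z(2)[OF that] by simp
    then show ?thesis
      using dirichlet_one_sums[OF that] by (simp add: powr_minus inverse_eq_divide del: of_nat_Suc)
  qed
  ultimately show "\<exists>f. zeta_continuation f"
    unfolding zeta_continuation_def by (intro exI[of _ ?f]) simp
next
  fix f g assume fg: "zeta_continuation f" "zeta_continuation g"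
  have "f s = g s" if "s \<noteq> 1" for s
  proof (rule analytic_continuation_open[of "{s. Re s > 1}" "- {1}" f g])
    show "{s. Re s > 1} \<noteq> {}" by (auto intro!: exI[of _ 2])
    show "connected (- {1 :: complex})" by (rule connected_punctured_universe) simp
    show "f s = g s" if "s \<in> {s. Re s > 1}" for s
      using fg that unfolding zeta_continuation_def by (blast intro: sums_unique2)
  qed (use fg that in \<open>auto simp: zeta_continuation_def intro: open_halfspace_Re_gt\<close>)
  then show "f = g"
    using fg unfolding zeta_continuation_def by (metis ext)
qed

lemma zeta_is_continuation: "zeta_continuation zeta"
  unfolding zeta_def by (rule theI'[OF zeta_unique_continuation])


section \<open>The functions \<open>\<xi>\<close> and \<open>\<Xi>\<close>\<close>

text \<open>
  At the removable singularities \<open>0, 1, -2, -4, \<dots>\<close> of the formula, the values of \<open>riemann_xi\<close> are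
  artefacts of totalisation. None of them is of the form \<open>1/2 + \<i> * t\<close> with real \<open>t\<close>.
\<close>

definition riemann_xi :: "complex \<Rightarrow> complex" where
  "riemann_xi s = s * (s - 1) / 2 * of_real pi powr (- s / 2) * Gamma (s / 2) * zeta s"

definition riemann_Xi :: "complex \<Rightarrow> complex" where
  "riemann_Xi z = riemann_xi (1 / 2 + \<i> * z)"


section \<open>Mean-value points and zeros in an interval\<close>

text \<open>
  The restriction of \<open>\<Xi>\<close> to the real axis takes real values, but it is kept complex-valued, so the
  following notions are formulated for complex-valued functions of a real variable.
\<close>

definition mean_value_points :: "(real \<Rightarrow> complex) \<Rightarrow> real \<Rightarrow> real \<Rightarrow> real set" where
  "mean_value_points f a b = {c \<in> {a<..<b}. integral {a..b} f = f c * of_real (b - a)}"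

definition zeros_between :: "(real \<Rightarrow> complex) \<Rightarrow> real \<Rightarrow> real \<Rightarrow> real set" where
  "zeros_between f a b = {\<gamma> \<in> {a<..<b}. f \<gamma> = 0}"

end

theory Submission
  imports Defs
begin

text \<open>
  The integral of \<open>\<Xi>\<close> over \<open>[\<omega>\<^sub>n, \<omega>\<^sub>n\<^sub>+\<^sub>1]\<close> is the difference of its integrals over the two rays
  starting at the end points, and both of these vanish (\<open>integral_eq_0_if_rays_eq_0\<close>). The mean
  value of \<open>\<Xi>\<close> on the interval is therefore \<open>0\<close>, so that it is attained exactly where \<open>\<Xi>\<close> vanishes.
  On the critical line, the factors of \<open>\<xi>\<close> other than \<open>\<zeta>\<close> have no zeros, which identifies the zeros
  of \<open>\<Xi>\<close> with those of \<open>\<zeta>\<close> (\<open>riemann_Xi_of_real_eq_0_iff\<close>).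
\<close>

lemma integral_eq_0_if_rays_eq_0:
  fixes f :: "real \<Rightarrow> 'a::banach"
  assumes "a \<le> b"
    and a: "(f has_integral 0) {a..}"
    and b: "(f has_integral 0) {b..}"
  shows "integral {a..b} f = 0"
proof -
  have "f integrable_on {a..b}"
    using integrable_on_subinterval[of f "{a..}" a b] a by (auto simp: integrable_on_def)
  then have "(f has_integral (integral {a..b} f + 0)) ({a..b} \<union> {b..})"
  proof (intro has_integral_Un integrable_integral b)
    have "{a..b} \<inter> {b..} = {b}" using \<open>a \<le> b\<close> by auto
    then show "negligible ({a..b} \<inter> {b..})" by simp
  qed
  also have "{a..b} \<union> {b..} = {a..}" using \<open>a \<le> b\<close> by auto
  finally show ?thesis using has_integral_unique[OF _ a] by simp
qed

lemma mean_value_points_eq_zeros_between: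
  assumes "integral {a..b} f = 0"
  shows "mean_value_points f a b = zeros_between f a b"
  using assms by (auto simp: mean_value_points_def zeros_between_def simp flip: of_real_diff)

text \<open>
  The point \<open>s = 1/2 + \<i> t\<close> is neither \<open>0\<close> nor \<open>1\<close>, the exponential \<open>\<pi> powr (- s / 2)\<close> never vanishes,
  and \<open>Gamma (s / 2)\<close> is nonzero because \<open>s / 2\<close> has positive real part and so is not a pole of
  \<open>Gamma\<close>, at which it would have the default value \<open>0\<close>.
\<close>

lemma riemann_Xi_of_real_eq_0_iff:
  fixes t :: real
  shows "riemann_Xi (of_real t) = 0 \<longleftrightarrow> zeta (1 / 2 + \<i> * of_real t) = 0"
proof -
  define s :: complex where "s = 1 / 2 + \<i> * of_real t"
  have Re: "Re s = 1 / 2" by (simp add: s_def)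
  then have "s \<noteq> 0" "s \<noteq> 1" by auto
  moreover have "Gamma (s / 2) \<noteq> 0"
    using Re by (auto simp: Gamma_eq_zero_iff elim!: nonpos_Ints_cases dest: arg_cong[of _ _ Re])
  moreover have "of_real pi powr (- s / 2) \<noteq> (0 :: complex)" by simp
  ultimately have "riemann_xi s = 0 \<longleftrightarrow> zeta s = 0" by (simp add: riemann_xi_def)
  then show ?thesis by (simp add: riemann_Xi_def s_def)
qed

theorem corollary3:
  fixes \<epsilon> :: real and \<omega> :: "nat \<Rightarrow> real"
  assumes "\<epsilon> > 0"
    and "strict_mono_on {1..} \<omega>"
    and "\<And>n. n \<ge> 1 \<Longrightarrow> \<omega> n > 0"
    and "\<And>n. n \<ge> 1 \<Longrightarrow> ((\<lambda>t::real. riemann_Xi (of_real t)) has_integral 0) {\<omega> n..}"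
    and "\<And>n. n \<ge> 1 \<Longrightarrow> \<omega> (n + 1) - \<omega> n < \<omega> n powr (1 / 6 + \<epsilon>)"
  shows "\<forall>n\<ge>1.
      mean_value_points (\<lambda>t. riemann_Xi (of_real t)) (\<omega> n) (\<omega> (n + 1)) =
        zeros_between (\<lambda>t. riemann_Xi (of_real t)) (\<omega> n) (\<omega> (n + 1)) \<and>
      (\<forall>\<gamma>\<in>{\<omega> n<..<\<omega> (n + 1)}.
        riemann_Xi (of_real \<gamma>) = 0 \<longleftrightarrow> zeta (1 / 2 + \<i> * of_real \<gamma>) = 0)"
proof (intro allI impI conjI ballI riemann_Xi_of_real_eq_0_iff mean_value_points_eq_zeros_between)
  fix n :: nat assume n: "n \<ge> 1"
  have "\<omega> n \<le> \<omega> (n + 1)"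
    using assms(2) n by (auto simp: strict_mono_on_def intro: less_imp_le)
  then show "integral {\<omega> n..\<omega> (n + 1)} (\<lambda>t. riemann_Xi (of_real t)) = 0"
    using assms(4)[of n] assms(4)[of "n + 1"] n by (intro integral_eq_0_if_rays_eq_0) auto
qed

end
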